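(* Let $(E,\mathcal{F},\tau)$ be a real locally convex space, $\psi:E\to\mathbb{R}$ a seminorm, $K, A\subseteq E$ nontrivial cones with normlike-bases $B_K$ and $B_A$ (with respect to $\psi$), and let $K$ be pointed. Define $S_{-K}:=\mathrm{conv}(-B_K)$ and $S_A^0:=\mathrm{conv}(B_A\cup\{0\})$. Suppose that one of the sets $\mathrm{cl}_\tau\,S_{-K}$ and $\mathrm{cl}_\tau\,S_A^0$ is $\tau$-compact. If $(\mathrm{cl}_\tau\,S_A^0)\cap(\mathrm{cl}_\tau\,S_{-K})=\emptyset$, then there exists $(x^*,\alpha)\in K_\tau^{a\#}\cap(E^*\times\mathbb{P})$ such that $$x^*(a)+\alpha\psi(a)\ \geq\ 0\ \geq\ x^*(k)+\alpha\psi(k)\quad\text{for all } a\in A\text{ and }k\in -K,$$ $$x^*(a)+\alpha\psi(a)\ >\ 0\ >\ x^*(k)+\alpha\psi(k)\quad\text{for all } a\in A\setminus\{0\}\text{ and }k\in -K\setminus\{0\}.$$ In particular, $A\cap(-K\setminus\{0\})=\emptyset$ and $0\notin\mathrm{cl}_\tau\,S_{-K}$.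
   Context: $(E,\mathcal{F},\tau)$ denotes a real locally convex space $E\neq\{0\}$ whose topology $\tau$ is generated by a family $\mathcal{F}$ of seminorms (not assumed Hausdorff). $E'$ is the algebraic dual and $E^*=(E,\tau)^*$ the topological dual; $\mathbb{R}_+=[0,\infty)$, $\mathbb{P}=(0,\infty)$. A set $K\subseteq E$ is a cone if $0\in K=\mathbb{R}_+\cdot K$ (not necessarily convex); it is nontrivial if $\{0\}\neq K\neq E$, pointed if $K\cap(-K)=\{0\}$. A seminorm is a sublinear symmetric function $\psi:E\to\mathbb{R}$ ($\psi$ is not assumed $\tau$-continuous). A nontrivial cone $K$ has a normlike-base (w.r.t. $\psi$) if $\psi(x)>0$ for all $x\in K\setminus\{0\}$; the normlike-base is then $B_K:=\{x\in K\mid \psi(x)=1\}$. All normlike-bases are taken with respect to the same fixed seminorm $\psi$. $\mathrm{cl}_\tau$ is $\tau$-closure, $\mathrm{conv}$ the convex hull; $\tau$-compact means every $\tau$-open cover has a finite subcover. $-K\setminus\{0\}$ means $(-K)\setminus\{0\}$. $K^\#:=\{y'\in E'\mid \forall k\in K\setminus\{0\}:\ y'(k)>0\}$, $K^{a\#}:=\{(x',\alpha)\in K^\#\times\mathbb{R}_+\mid \forall y\in K\setminus\{0\}:\ x'(y)-\alpha\psi(y)>0\}$, and $K_\tau^{a\#}:=K^{a\#}\cap(E^*\times\mathbb{R})$. *)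

theory Defs
  imports "HOL-Analysis.Analysis"
begin

definition seminorm :: "('a::real_vector \<Rightarrow> real) \<Rightarrow> bool" where
  "seminorm p \<longleftrightarrow>
     (\<forall>x y. p (x + y) \<le> p x + p y) \<and>
     (\<forall>t\<ge>0. \<forall>x. p (t *\<^sub>R x) = t * p x) \<and>
     (\<forall>x. p (- x) = p x)"

(* UNIV is added to the subbasis because topology_generated_by takes the union of the
   subbasis as the underlying space; without it F = {} would give the empty space. *)
definition seminorm_topology :: "('a::real_vector \<Rightarrow> real) set \<Rightarrow> 'a topology" where
  "seminorm_topology F =
     topology_generated_by (insert UNIV {{y. p (y - x) < r} |p x r. p \<in> F \<and> 0 < r})"

(* The whole type 'a is the vector space; E is nonzero, and tau need not be Hausdorff. *)
definition locally_convex_space :: "('a::real_vector \<Rightarrow> real) set \<Rightarrow> 'a topology \<Rightarrow> bool" where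
  "locally_convex_space F \<tau> \<longleftrightarrow>
     (UNIV :: 'a set) \<noteq> {0} \<and> (\<forall>p\<in>F. seminorm p) \<and> \<tau> = seminorm_topology F"

lemma topspace_seminorm_topology [simp]: "topspace (seminorm_topology F) = UNIV"
  by (simp add: seminorm_topology_def)

definition algebraic_dual :: "('a::real_vector \<Rightarrow> real) set" where
  "algebraic_dual = {f. linear f}"

definition topological_dual :: "'a::real_vector topology \<Rightarrow> ('a \<Rightarrow> real) set" where
  "topological_dual \<tau> = {f \<in> algebraic_dual. continuous_map \<tau> euclideanreal f}"

(* The library predicate cone does not require 0 to belong to the set. *)
definition nontrivial_cone :: "'a::real_vector set \<Rightarrow> bool" where
  "nontrivial_cone K \<longleftrightarrow> 0 \<in> K \<and> cone K \<and> K \<noteq> {0} \<and> K \<noteq> UNIV"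

lemma cone_iff_scaled_eq: "cone K \<longleftrightarrow> K = {t *\<^sub>R x |t x. 0 \<le> t \<and> x \<in> K}"
proof
  assume K: "cone K"
  have "x \<in> {t *\<^sub>R x |t x. 0 \<le> t \<and> x \<in> K}" if "x \<in> K" for x
    using that by (intro CollectI exI[of _ 1] exI[of _ x]) simp
  moreover have "t *\<^sub>R x \<in> K" if "0 \<le> t" "x \<in> K" for t x
    using K that by (simp add: cone_def)
  ultimately show "K = {t *\<^sub>R x |t x. 0 \<le> t \<and> x \<in> K}"
    by blast
next
  assume "K = {t *\<^sub>R x |t x. 0 \<le> t \<and> x \<in> K}"
  then show "cone K"
    unfolding cone_def by blast
qed

definition pointed :: "'a::real_vector set \<Rightarrow> bool" where
  "pointed K \<longleftrightarrow> K \<inter> uminus ` K = {0}"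

definition has_normlike_base :: "('a::real_vector \<Rightarrow> real) \<Rightarrow> 'a set \<Rightarrow> bool" where
  "has_normlike_base \<psi> K \<longleftrightarrow> (\<forall>x\<in>K - {0}. \<psi> x > 0)"

definition normlike_base :: "('a::real_vector \<Rightarrow> real) \<Rightarrow> 'a set \<Rightarrow> 'a set" where
  "normlike_base \<psi> K = {x \<in> K. \<psi> x = 1}"

(* The set S_{-K} = conv(-B_K). *)
definition S_neg :: "('a::real_vector \<Rightarrow> real) \<Rightarrow> 'a set \<Rightarrow> 'a set" where
  "S_neg \<psi> K = convex hull (uminus ` normlike_base \<psi> K)"

(* The set S_A^0 = conv(B_A \<union> {0}). *)
definition S_zero :: "('a::real_vector \<Rightarrow> real) \<Rightarrow> 'a set \<Rightarrow> 'a set" where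
  "S_zero \<psi> A = convex hull (normlike_base \<psi> A \<union> {0})"

(* The sets K^#, K^{a#} and K_tau^{a#}. *)
definition sharp_cone :: "'a::real_vector set \<Rightarrow> ('a \<Rightarrow> real) set" where
  "sharp_cone K = {y' \<in> algebraic_dual. \<forall>k\<in>K - {0}. y' k > 0}"

definition aug_sharp :: "('a::real_vector \<Rightarrow> real) \<Rightarrow> 'a set \<Rightarrow> (('a \<Rightarrow> real) \<times> real) set" where
  "aug_sharp \<psi> K =
     {(x', \<alpha>) \<in> sharp_cone K \<times> {0..}. \<forall>y\<in>K - {0}. x' y - \<alpha> * \<psi> y > 0}"

definition aug_sharp_top ::
    "'a::real_vector topology \<Rightarrow> ('a \<Rightarrow> real) \<Rightarrow> 'a set \<Rightarrow> (('a \<Rightarrow> real) \<times> real) set" where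
  "aug_sharp_top \<tau> \<psi> K = aug_sharp \<psi> K \<inter> (topological_dual \<tau> \<times> UNIV)"

end

theory Submission
  imports Defs
begin

text \<open>
  Compactness of one closure turns disjointness of the closures into a uniform gap: some continuous
  seminorm \<open>q\<close> satisfies \<open>q (c - d) \<ge> 1\<close> for all \<open>c \<in> S_A^0\<close> and \<open>d \<in> S_{-K}\<close>. Hahn-Banach,
  in the form that minimal sublinear functionals are linear, then gives a linear
  \<open>f \<le> q\<close> with \<open>f (c - d) \<ge> 1\<close>, so \<open>f\<close> is continuous and a level \<open>- \<alpha>\<close> lies strictly between
  \<open>f ` S_{-K}\<close> and \<open>f ` S_A^0\<close>. As \<open>0 \<in> S_A^0\<close>, \<open>\<alpha>\<close> is positive, and homogeneity carries the
  inequalities from the normlike-bases to the cones.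
\<close>

section \<open>Sublinear functionals and their tilts\<close>

text \<open>Symmetry, which \<open>seminorm\<close> demands, is left out: the functionals obtained
  by tilting are not symmetric in general, and a linear functional is itself sublinear.\<close>

definition sublinear :: "('a::real_vector \<Rightarrow> real) \<Rightarrow> bool" where
  "sublinear p \<longleftrightarrow>
     (\<forall>x y. p (x + y) \<le> p x + p y) \<and> (\<forall>t\<ge>0. \<forall>x. p (t *\<^sub>R x) = t * p x)"

lemma sublinearD:
  assumes "sublinear p"
  shows "p (x + y) \<le> p x + p y" and "0 \<le> t \<Longrightarrow> p (t *\<^sub>R x) = t * p x"
  using assms by (auto simp: sublinear_def)

lemma sublinear_zero: "sublinear p \<Longrightarrow> p 0 = 0"
  using sublinearD(2)[of p 0 0] by simp

lemma sublinear_uminus_le: "sublinear p \<Longrightarrow> - p (- x) \<le> p x"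
  using sublinearD(1)[of p x "- x"] sublinear_zero[of p] by simp

text \<open>The reverse inequality comes from applying \<open>le\<close> to the factor
  \<open>inverse t\<close> and the point \<open>t *\<^sub>R x\<close>. For functionals defined by
  infima, only one direction then has to be estimated.\<close>

lemma sublinear_pos_homogeneousI:
  fixes p :: "'a::real_vector \<Rightarrow> real"
  assumes zero: "p 0 = 0" and le: "\<And>t x. 0 < t \<Longrightarrow> p (t *\<^sub>R x) \<le> t * p x"
    and "0 \<le> t"
  shows "p (t *\<^sub>R x) = t * p x"
proof (cases "t = 0")
  case False
  then have t: "0 < t" using \<open>0 \<le> t\<close> by simp
  have "p (inverse t *\<^sub>R (t *\<^sub>R x)) \<le> inverse t * p (t *\<^sub>R x)"
    using t by (intro le) simp
  then have "p x \<le> inverse t * p (t *\<^sub>R x)"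
    using t by simp
  then have "t * p x \<le> p (t *\<^sub>R x)"
    using t by (simp add: field_simps)
  with le[OF t, of x] show ?thesis by simp
qed (simp add: zero)

text \<open>
  The largest sublinear functional below \<open>p\<close> whose linear minorants are all \<open>\<ge> c\<close> on \<open>W\<close>. Taking
  \<open>W = {y}\<close> and \<open>c = p y\<close> shows that a minimal \<open>p\<close> is additive.
\<close>

definition tilt :: "('a::real_vector \<Rightarrow> real) \<Rightarrow> 'a set \<Rightarrow> real \<Rightarrow> 'a \<Rightarrow> real" where
  "tilt p W c x = (INF (t, w) \<in> {0..} \<times> W. p (x + t *\<^sub>R w) - t * c)"

context
  fixes p :: "'a::real_vector \<Rightarrow> real" and W :: "'a set" and c :: real
  assumes p: "sublinear p" and W: "convex W" "W \<noteq> {}" and c: "\<And>w. w \<in> W \<Longrightarrow> c \<le> p w"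
begin

text \<open>The bound does not depend on \<open>t\<close> and \<open>w\<close>. It makes the infimum
  in \<open>tilt\<close> a genuine one, since \<open>INF\<close> on the reals says nothing useful
  about a family that is unbounded below.\<close>

lemma tilt_lower:
  assumes "0 \<le> t" "w \<in> W"
  shows "- p (- x) \<le> p (x + t *\<^sub>R w) - t * c"
proof -
  have "t * c \<le> p (t *\<^sub>R w)"
    using c[OF assms(2)] sublinearD(2)[OF p assms(1)] assms(1) by (simp add: mult_left_mono)
  also have "\<dots> \<le> p (x + t *\<^sub>R w) + p (- x)"
    using sublinearD(1)[OF p, of "x + t *\<^sub>R w" "- x"] by simp
  finally show ?thesis by simp
qed

lemma tilt_le:
  assumes "0 \<le> t" "w \<in> W"
  shows "tilt p W c x \<le> p (x + t *\<^sub>R w) - t * c"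
proof -
  have "bdd_below ((\<lambda>(t, w). p (x + t *\<^sub>R w) - t * c) ` ({0..} \<times> W))"
    using tilt_lower by (intro bdd_belowI[of _ "- p (- x)"]) auto
  from cINF_lower[OF this, of "(t, w)"] show ?thesis
    using assms by (simp add: tilt_def)
qed

lemma tilt_greatest:
  assumes "\<And>t w. 0 \<le> t \<Longrightarrow> w \<in> W \<Longrightarrow> b \<le> p (x + t *\<^sub>R w) - t * c"
  shows "b \<le> tilt p W c x"
  unfolding tilt_def using assms W(2) by (intro cINF_greatest) auto

lemma tilt_le_self: "tilt p W c x \<le> p x"
  using tilt_le[of 0] W(2) by fastforce

text \<open>The choice \<open>t = 1\<close> moves \<open>- w\<close> to the origin. A linear
  functional below the tilt is therefore at most \<open>- c\<close> at \<open>- w\<close>, hence at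
  least \<open>c\<close> at \<open>w\<close>.\<close>

lemma tilt_uminus_le: "w \<in> W \<Longrightarrow> tilt p W c (- w) \<le> - c"
  using tilt_le[of 1 w "- w"] sublinear_zero[OF p] by simp

lemma tilt_sublinear: "sublinear (tilt p W c)"
  unfolding sublinear_def
proof (intro conjI allI impI)
  fix x y
  have key: "tilt p W c (x + y) \<le> (p (x + s *\<^sub>R v) - s * c) + (p (y + t *\<^sub>R w) - t * c)"
    if st: "0 \<le> s" "v \<in> W" "0 \<le> t" "w \<in> W" for s t v w
  proof -
    \<comment> \<open>Here convexity of \<open>W\<close> enters: the two admissible pairs merge into
      the single pair \<open>(s + t, u)\<close>, with \<open>u\<close> their weighted mean. If both
      weights vanish, any point of \<open>W\<close> serves.\<close>
    obtain u where u: "u \<in> W" "(s + t) *\<^sub>R u = s *\<^sub>R v + t *\<^sub>R w"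
    proof (cases "s + t = 0")
      case True
      then have "s = 0" "t = 0" using st by auto
      then show ?thesis using st that by auto
    next
      case False
      then have "(s / (s + t)) *\<^sub>R v + (t / (s + t)) *\<^sub>R w \<in> W"
        using st by (intro convexD[OF W(1)]) (simp_all add: add_divide_distrib[symmetric])
      moreover have "(s + t) *\<^sub>R ((s / (s + t)) *\<^sub>R v + (t / (s + t)) *\<^sub>R w) = s *\<^sub>R v + t *\<^sub>R w"
        using False by (simp add: scaleR_add_right)
      ultimately show ?thesis by (rule that)
    qed
    have "tilt p W c (x + y) \<le> p (x + y + (s + t) *\<^sub>R u) - (s + t) * c"
      using u st by (intro tilt_le) auto
    also have "x + y + (s + t) *\<^sub>R u = (x + s *\<^sub>R v) + (y + t *\<^sub>R w)"
      using u by simp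
    finally show ?thesis
      using sublinearD(1)[OF p, of "x + s *\<^sub>R v" "y + t *\<^sub>R w"] by (simp add: distrib_right)
  qed
  \<comment> \<open>The two infima are taken one after the other: first over \<open>(t, w)\<close>
    with \<open>(s, v)\<close> fixed, then over \<open>(s, v)\<close>.\<close>
  have "tilt p W c (x + y) - (p (x + s *\<^sub>R v) - s * c) \<le> tilt p W c y" if "0 \<le> s" "v \<in> W" for s v
    using key[OF that] by (intro tilt_greatest) (simp add: algebra_simps)
  then have "tilt p W c (x + y) - tilt p W c y \<le> tilt p W c x"
    by (intro tilt_greatest) (simp add: algebra_simps)
  then show "tilt p W c (x + y) \<le> tilt p W c x + tilt p W c y" by simp
next
  fix t :: real and x
  assume "0 \<le> t"
  have "tilt p W c 0 = 0"
    using tilt_le_self[of 0] tilt_greatest[of 0 0] tilt_lower[of _ _ 0] sublinear_zero[OF p]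
    by (metis antisym minus_zero)
  moreover have "tilt p W c (t *\<^sub>R x) \<le> t * tilt p W c x" if t: "0 < t" for t x
  proof -
    have "inverse t * tilt p W c (t *\<^sub>R x) \<le> p (x + s *\<^sub>R w) - s * c" if "0 \<le> s" "w \<in> W" for s w
    proof -
      have "tilt p W c (t *\<^sub>R x) \<le> p (t *\<^sub>R x + (t * s) *\<^sub>R w) - (t * s) * c"
        using that t by (intro tilt_le) auto
      also have "t *\<^sub>R x + (t * s) *\<^sub>R w = t *\<^sub>R (x + s *\<^sub>R w)"
        by (simp add: scaleR_add_right)
      also have "p \<dots> - (t * s) * c = t * (p (x + s *\<^sub>R w) - s * c)"
        using t sublinearD(2)[OF p, of t] by (simp add: right_diff_distrib)
      finally show ?thesis using t by (simp add: field_simps)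
    qed
    then have "inverse t * tilt p W c (t *\<^sub>R x) \<le> tilt p W c x"
      by (rule tilt_greatest)
    then show ?thesis using t by (simp add: field_simps)
  qed
  ultimately show "tilt p W c (t *\<^sub>R x) = t * tilt p W c x"
    using \<open>0 \<le> t\<close> by (rule sublinear_pos_homogeneousI)
qed

end

section \<open>The Hahn-Banach theorem by minimal sublinear functionals\<close>

lemma minimal_sublinear_imp_linear:
  assumes m: "sublinear m" and minimal: "\<And>r. sublinear r \<Longrightarrow> r \<le> m \<Longrightarrow> r = m"
  shows "linear m"
proof -
  have ge: "m x + m y \<le> m (x + y)" for x y
  proof -
    \<comment> \<open>The tilt is a sublinear minorant of \<open>m\<close>, so minimality forces
      equality; its defining bound at \<open>t = 1\<close> is then superadditivity of
      \<open>m\<close>.\<close>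
    have "tilt m {y} (m y) = m"
      using m by (intro minimal tilt_sublinear le_funI tilt_le_self) auto
    then show ?thesis
      using tilt_le[OF m, of "{y}" "m y" 1 y x] by simp
  qed
  have add: "m (x + y) = m x + m y" for x y
    using ge[of x y] sublinearD(1)[OF m, of x y] by simp
  then have minus: "m (- x) = - m x" for x
    using add[of x "- x"] sublinear_zero[OF m] by simp
  have "m (t *\<^sub>R x) = t *\<^sub>R m x" for t x
  proof (cases "0 \<le> t")
    case False
    then show ?thesis
      using sublinearD(2)[OF m, of "- t" x] minus[of "t *\<^sub>R x"] by simp
  qed (simp add: sublinearD(2)[OF m])
  with add show ?thesis by (intro linearI)
qed

text \<open>A pointwise infimum of sublinear functionals can fail to be subadditive. In a chain, the
  smaller of \<open>r\<close> and \<open>s\<close> bounds the infimum at \<open>x + y\<close> by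
  \<open>r x + s y\<close>, which is what subadditivity needs.\<close>

lemma sublinear_INF_chain:
  fixes C :: "('a::real_vector \<Rightarrow> real) set"
  assumes C: "C \<noteq> {}" "\<And>r. r \<in> C \<Longrightarrow> sublinear r" "\<And>r s. r \<in> C \<Longrightarrow> s \<in> C \<Longrightarrow> r \<le> s \<or> s \<le> r"
    and bdd: "\<And>x. bdd_below ((\<lambda>r. r x) ` C)"
  shows "sublinear (\<lambda>x. INF r\<in>C. r x)"
proof -
  define u where "u x = (INF r\<in>C. r x)" for x
  have lower: "u x \<le> r x" if "r \<in> C" for r x
    unfolding u_def using bdd that by (rule cINF_lower)
  have greatest: "b \<le> u x" if "\<And>r. r \<in> C \<Longrightarrow> b \<le> r x" for b x
    unfolding u_def using C(1) that by (rule cINF_greatest)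
  have key: "u (x + y) \<le> r x + s y" if rs: "r \<in> C" "s \<in> C" for r s x y
  proof -
    from C(3)[OF rs] obtain v where v: "v \<in> C" "v \<le> r" "v \<le> s"
      using rs by auto
    then have "u (x + y) \<le> v (x + y)" "v x \<le> r x" "v y \<le> s y"
      by (auto intro: lower le_funD)
    then show ?thesis using sublinearD(1)[OF C(2)[OF v(1)], of x y] by simp
  qed
  have sub: "u (x + y) \<le> u x + u y" for x y
  proof -
    have "u (x + y) - r x \<le> u y" if "r \<in> C" for r
      using key[OF that] by (intro greatest) (simp add: algebra_simps)
    then have "u (x + y) - u y \<le> u x"
      by (intro greatest) (simp add: algebra_simps)
    then show ?thesis by simp
  qed
  have hom: "u (t *\<^sub>R x) = t * u x" if "0 \<le> t" for t x
  proof (rule sublinear_pos_homogeneousI[OF _ _ that])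
    show "u 0 = 0"
      using C(1) sublinear_zero[OF C(2)] by (intro antisym greatest) (use lower[of _ 0] in force)+
    show "u (t *\<^sub>R x) \<le> t * u x" if t: "0 < t" for t x
    proof -
      have "inverse t * u (t *\<^sub>R x) \<le> u x"
        using lower[of _ "t *\<^sub>R x"] sublinearD(2)[OF C(2)] t
        by (intro greatest) (simp add: field_simps)
      then show ?thesis using t by (simp add: field_simps)
    qed
  qed
  from sub hom have "sublinear u" by (simp add: sublinear_def)
  then show ?thesis by (simp add: u_def[abs_def])
qed

lemma sublinear_dominates_linear:
  assumes p: "sublinear (p :: 'a::real_vector \<Rightarrow> real)"
  obtains f where "linear f" "f \<le> p"
proof -
  define S where "S = {r. sublinear r \<and> r \<le> p}"
  have "\<exists>m\<in>S. \<forall>a\<in>S. a \<le> m \<longrightarrow> a = m"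
  proof (rule predicate_Zorn)
    \<comment> \<open>The order is reversed, so that the maximal element given by Zorn's lemma is a
      minimal sublinear functional.\<close>
    show "partial_order_on S (relation_of (\<lambda>r s. s \<le> r) S)"
      by (auto simp: partial_order_on_def preorder_on_def relation_of_def refl_on_def
          antisym_def trans_def intro: order_trans)
    fix C assume "C \<in> Chains (relation_of (\<lambda>r s. s \<le> r) S)"
    then have CS: "C \<subseteq> S" and chain: "\<And>r s. r \<in> C \<Longrightarrow> s \<in> C \<Longrightarrow> r \<le> s \<or> s \<le> r"
      by (auto simp: Chains_def relation_of_def)
    show "\<exists>u\<in>S. \<forall>a\<in>C. u \<le> a"
    proof (cases "C = {}")
      case True
      with p show ?thesis by (auto simp: S_def)
    next
      case False
      \<comment> \<open>Every sublinear \<open>r \<le> p\<close> satisfies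
        \<open>- p (- x) \<le> - r (- x) \<le> r x\<close>, a bound common to the whole
        chain.\<close>
      have bdd: "bdd_below ((\<lambda>r. r x) ` C)" for x
      proof (rule bdd_belowI)
        fix b assume "b \<in> (\<lambda>r. r x) ` C"
        then obtain r where r: "r \<in> S" "b = r x" using CS by auto
        then have "r (- x) \<le> p (- x)" by (auto simp: S_def le_fun_def)
        with r show "- p (- x) \<le> b"
          using sublinear_uminus_le[of r x] by (simp add: S_def)
      qed
      let ?u = "\<lambda>x. INF r\<in>C. r x"
      have "sublinear ?u"
        using False CS chain bdd by (intro sublinear_INF_chain) (auto simp: S_def)
      moreover have lower: "?u \<le> r" if "r \<in> C" for r
        using cINF_lower[OF bdd that] by (intro le_funI)
      moreover from False obtain r where "r \<in> C" by auto
      ultimately have "?u \<in> S"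
        using CS by (auto simp: S_def intro: order_trans[of ?u r p])
      with lower show ?thesis by blast
    qed
  qed
  then obtain m where m: "sublinear m" "m \<le> p" "\<And>a. a \<in> S \<Longrightarrow> a \<le> m \<Longrightarrow> a = m"
    by (auto simp: S_def)
  \<comment> \<open>Minimality within \<open>S\<close> suffices, because a sublinear functional
    below \<open>m\<close> is also below \<open>p\<close> and so belongs to
    \<open>S\<close>.\<close>
  have "linear m"
    using m by (intro minimal_sublinear_imp_linear) (auto simp: S_def intro: order_trans)
  with m(2) show ?thesis by (rule that[rotated])
qed

lemma linear_below_sublinear_above_one:
  assumes q: "sublinear q" and W: "convex W" "W \<noteq> {}" and ge: "\<And>w. w \<in> W \<Longrightarrow> 1 \<le> q w"
  obtains f where "linear f" "f \<le> q" "\<And>w. w \<in> W \<Longrightarrow> 1 \<le> f w"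
proof -
  obtain f where f: "linear f" "f \<le> tilt q W 1"
    using sublinear_dominates_linear[OF tilt_sublinear[OF q W ge]] by blast
  show ?thesis
  proof
    show "f \<le> q"
      using f(2) tilt_le_self[OF q W ge] by (auto simp: le_fun_def intro: order_trans)
    show "1 \<le> f w" if "w \<in> W" for w
      using le_funD[OF f(2), of "- w"] tilt_uminus_le[OF q W ge that] linear_neg[OF f(1), of w]
      by simp
  qed (fact f)
qed

section \<open>Continuous seminorms and the topology they generate\<close>

lemma seminormD:
  assumes "seminorm p"
  shows "p (x + y) \<le> p x + p y" "0 \<le> t \<Longrightarrow> p (t *\<^sub>R x) = t * p x" "p (- x) = p x"
  using assms by (auto simp: seminorm_def)

lemma seminorm_imp_sublinear: "seminorm p \<Longrightarrow> sublinear p"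
  by (simp add: seminorm_def sublinear_def)

lemma seminorm_zero: "seminorm p \<Longrightarrow> p 0 = 0"
  by (simp add: seminorm_imp_sublinear sublinear_zero)

lemma seminorm_nonneg: "seminorm p \<Longrightarrow> 0 \<le> p x"
  using sublinear_uminus_le[of p x] by (simp add: seminorm_imp_sublinear seminormD)

lemma seminorm_minus_commute: "seminorm p \<Longrightarrow> p (x - y) = p (y - x)"
  using seminormD(3)[of p "x - y"] by simp

lemma seminorm_triangle: "seminorm p \<Longrightarrow> p (x - z) \<le> p (x - y) + p (y - z)"
  using seminormD(1)[of p "x - y" "y - z"] by simp

lemma seminorm_add: "seminorm p \<Longrightarrow> seminorm q \<Longrightarrow> seminorm (\<lambda>x. p x + q x)"
  unfolding seminorm_def by (auto simp: distrib_left) (smt (verit))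

lemma seminorm_scale: "seminorm p \<Longrightarrow> 0 \<le> t \<Longrightarrow> seminorm (\<lambda>x. t * p x)"
  unfolding seminorm_def by (auto simp: distrib_left[symmetric] intro: mult_left_mono)

text \<open>This expresses continuity of the seminorm by openness of its balls. Unlike the
  generating family, this class is closed under sums and positive multiples, so one member can
  replace finitely many generators.\<close>

definition cont_seminorm :: "'a::real_vector topology \<Rightarrow> ('a \<Rightarrow> real) \<Rightarrow> bool" where
  "cont_seminorm \<tau> q \<longleftrightarrow> seminorm q \<and> (\<forall>x r. 0 < r \<longrightarrow> openin \<tau> {y. q (y - x) < r})"

lemma lipschitz_imp_continuous_map:
  assumes q: "cont_seminorm \<tau> q" and g: "\<And>x y. \<bar>g y - g x\<bar> \<le> q (y - x)"
  shows "continuous_map \<tau> euclideanreal g"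
  unfolding continuous_map
proof (intro conjI allI impI)
  fix U :: "real set" assume "openin euclideanreal U"
  then have U: "open U" by simp
  show "openin \<tau> {x \<in> topspace \<tau>. g x \<in> U}"
  proof (subst openin_subopen, intro ballI)
    fix x assume x: "x \<in> {x \<in> topspace \<tau>. g x \<in> U}"
    then obtain e where e: "0 < e" "\<And>z. \<bar>z - g x\<bar> < e \<Longrightarrow> z \<in> U"
      using U by (auto simp: open_dist dist_real_def)
    let ?T = "{y. q (y - x) < e}"
    have T: "openin \<tau> ?T" using q e by (simp add: cont_seminorm_def)
    moreover have "x \<in> ?T"
      using q e by (simp add: cont_seminorm_def seminorm_zero)
    moreover have "?T \<subseteq> {x \<in> topspace \<tau>. g x \<in> U}"
      using openin_subset[OF T] e(2) g[of _ x] by (auto intro: le_less_trans)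
    ultimately show "\<exists>T. openin \<tau> T \<and> x \<in> T \<and> T \<subseteq> {x \<in> topspace \<tau>. g x \<in> U}"
      by blast
  qed
qed simp

lemma cont_seminorm_add:
  assumes "cont_seminorm \<tau> p" "cont_seminorm \<tau> q"
  shows "cont_seminorm \<tau> (\<lambda>x. p x + q x)"
  unfolding cont_seminorm_def
proof (intro conjI allI impI)
  fix x and r :: real assume "0 < r"
  have cont: "continuous_map \<tau> euclideanreal (\<lambda>y. s (y - x))" if s: "cont_seminorm \<tau> s" for s
  proof (rule lipschitz_imp_continuous_map[OF s])
    fix y z
    from s have "seminorm s" by (simp add: cont_seminorm_def)
    then show "\<bar>s (z - x) - s (y - x)\<bar> \<le> s (z - y)"
      using seminorm_triangle[of s z x y] seminorm_triangle[of s y x z]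
        seminorm_minus_commute[of s y z] by linarith
  qed
  \<comment> \<open>The topology is arbitrary here, so membership in its underlying space is read
    off from the open \<open>p\<close>-balls, which contain the balls of the sum.\<close>
  have sub: "{y. p (y - x) < r} \<subseteq> topspace \<tau>"
    using assms(1) \<open>0 < r\<close> by (intro openin_subset) (auto simp: cont_seminorm_def)
  have "y \<in> topspace \<tau>" if "p (y - x) + q (y - x) < r" for y
  proof -
    have "0 \<le> q (y - x)"
      using assms(2) by (simp add: cont_seminorm_def seminorm_nonneg)
    with that sub show ?thesis by auto
  qed
  then have "{y. p (y - x) + q (y - x) < r} = {y \<in> topspace \<tau>. p (y - x) + q (y - x) \<in> {..<r}}"
    by auto
  moreover have "openin \<tau> \<dots>"
    using assms by (intro openin_continuous_map_preimage[of _ euclideanreal] continuous_map_add cont) auto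
  ultimately show "openin \<tau> {y. p (y - x) + q (y - x) < r}" by simp
qed (use assms in \<open>simp add: cont_seminorm_def seminorm_add\<close>)

lemma cont_seminorm_zero:
  assumes "topspace \<tau> = UNIV" shows "cont_seminorm \<tau> (\<lambda>x. 0)"
  using openin_topspace[of \<tau>] assms by (simp add: cont_seminorm_def seminorm_def)

lemma cont_seminorm_scale:
  assumes q: "cont_seminorm \<tau> q" and t: "0 < t"
  shows "cont_seminorm \<tau> (\<lambda>x. t * q x)"
proof -
  have "{y. t * q (y - x) < r} = {y. q (y - x) < r / t}" for x r
    using t by (auto simp: field_simps)
  then show ?thesis
    using q t by (simp add: cont_seminorm_def seminorm_scale)
qed

lemma cont_seminorm_sum:
  assumes "topspace \<tau> = UNIV" "finite I" "\<And>i. i \<in> I \<Longrightarrow> cont_seminorm \<tau> (q i)"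
  shows "cont_seminorm \<tau> (\<lambda>x. \<Sum>i\<in>I. q i x)"
  using assms(2,3)
  by (induction I rule: finite_induct) (auto simp: cont_seminorm_zero[OF assms(1)] intro: cont_seminorm_add)

lemma cont_seminorm_generator:
  assumes "p \<in> F" "seminorm p"
  shows "cont_seminorm (seminorm_topology F) p"
  unfolding cont_seminorm_def seminorm_topology_def
  using assms by (auto intro!: topology_generated_by_Basis)

text \<open>Induction on the generation of open sets: a finite intersection is absorbed by adding
  seminorms, and the radius of a subbasic ball by rescaling, so radius 1 always suffices.\<close>

lemma openin_seminorm_topology_ball:
  fixes F :: "('a::real_vector \<Rightarrow> real) set"
  assumes F: "\<And>p. p \<in> F \<Longrightarrow> seminorm p"
    and "openin (seminorm_topology F) U" "x \<in> U"
  obtains q where "cont_seminorm (seminorm_topology F) q" "\<And>y. q (y - x) < 1 \<Longrightarrow> y \<in> U"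
proof -
  let ?\<tau> = "seminorm_topology F"
  have "generate_topology_on (insert UNIV {{y. p (y - x) < r} |p x r. p \<in> F \<and> 0 < r}) U"
    using assms(2) by (simp add: seminorm_topology_def openin_topology_generated_by_iff)
  then have "x \<in> U \<longrightarrow> (\<exists>q. cont_seminorm ?\<tau> q \<and> (\<forall>y. q (y - x) < 1 \<longrightarrow> y \<in> U))"
  proof induction
    case (Int a b)
    show ?case
    proof
      assume "x \<in> a \<inter> b"
      with Int obtain p q where pq: "cont_seminorm ?\<tau> p" "\<forall>y. p (y - x) < 1 \<longrightarrow> y \<in> a"
        "cont_seminorm ?\<tau> q" "\<forall>y. q (y - x) < 1 \<longrightarrow> y \<in> b"
        by blast
      then have "p z < 1 \<and> q z < 1" if "p z + q z < 1" for z
        using that seminorm_nonneg[of p z] seminorm_nonneg[of q z] by (auto simp: cont_seminorm_def)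
      with pq show "\<exists>q. cont_seminorm ?\<tau> q \<and> (\<forall>y. q (y - x) < 1 \<longrightarrow> y \<in> a \<inter> b)"
        by (intro exI[of _ "\<lambda>x. p x + q x"]) (blast intro: cont_seminorm_add)
    qed
  next
    case (UN \<U>)
    then show ?case by blast
  next
    case (Basis s)
    then consider "s = UNIV" | p z r where "s = {y. p (y - z) < r}" "p \<in> F"
      by auto
    then show ?case
    proof cases
      case 1
      then show ?thesis using cont_seminorm_zero[of ?\<tau>] by auto
    next
      case (2 p z r)
      show ?thesis
      proof
        assume "x \<in> s"
        \<comment> \<open>The \<open>p\<close>-ball of radius \<open>r - p (x - z)\<close> about
          \<open>x\<close> lies inside \<open>s\<close>; dividing \<open>p\<close> by this radius
          normalises it to 1.\<close>
        with 2 have pos: "0 < r - p (x - z)" by simp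
        have "p (y - z) < r" if "inverse (r - p (x - z)) * p (y - x) < 1" for y
        proof -
          have "p (y - x) < r - p (x - z)"
            using that pos by (simp add: field_simps)
          then show ?thesis
            using seminorm_triangle[OF F[OF 2(2)], of y z x] by simp
        qed
        moreover have "cont_seminorm ?\<tau> (\<lambda>y. inverse (r - p (x - z)) * p y)"
          using pos 2 F by (intro cont_seminorm_scale cont_seminorm_generator) auto
        ultimately show "\<exists>q. cont_seminorm ?\<tau> q \<and> (\<forall>y. q (y - x) < 1 \<longrightarrow> y \<in> s)"
          using 2(1) by blast
      qed
    qed
  qed simp
  with \<open>x \<in> U\<close> that show ?thesis by blast
qed

section \<open>Separation of convex sets with disjoint closures\<close>

text \<open>Each point of \<open>D\<close> has its own continuous seminorm keeping it away from
  \<open>C\<close>. Compactness leaves finitely many of them, and their sum works for all points at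
  once.\<close>

lemma compact_closed_uniform_gap:
  fixes F :: "('a::real_vector \<Rightarrow> real) set"
  defines "\<tau> \<equiv> seminorm_topology F"
  assumes F: "\<And>p. p \<in> F \<Longrightarrow> seminorm p"
    and C: "closedin \<tau> C" and D: "compactin \<tau> D" and disj: "C \<inter> D = {}"
  obtains q where "cont_seminorm \<tau> q" "\<And>c d. c \<in> C \<Longrightarrow> d \<in> D \<Longrightarrow> 1 \<le> q (c - d)"
proof -
  have top: "topspace \<tau> = UNIV" by (simp add: \<tau>_def)
  \<comment> \<open>The distance 2 leaves room for the triangle inequality: passing from the centre
    of a covering unit ball to a point in it costs less than 1.\<close>
  have "\<exists>q. cont_seminorm \<tau> q \<and> (\<forall>c\<in>C. 2 \<le> q (c - d))" if "d \<in> D" for d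
  proof -
    have "openin \<tau> (- C)" using C top by (simp add: closedin_def Compl_eq_Diff_UNIV)
    moreover have "d \<in> - C" using that disj by auto
    ultimately obtain q where q: "cont_seminorm \<tau> q" "\<And>y. q (y - d) < 1 \<Longrightarrow> y \<in> - C"
      using openin_seminorm_topology_ball[OF F] unfolding \<tau>_def by blast
    have "1 \<le> q (c - d)" if "c \<in> C" for c
      using q(2)[of c] that by force
    with cont_seminorm_scale[OF q(1), of 2] show ?thesis
      by (intro exI[of _ "\<lambda>x. 2 * q x"]) auto
  qed
  then obtain q where q: "\<And>d. d \<in> D \<Longrightarrow> cont_seminorm \<tau> (q d)"
      "\<And>d c. d \<in> D \<Longrightarrow> c \<in> C \<Longrightarrow> 2 \<le> q d (c - d)"
    by metis
  define B where "B d = {y. q d (y - d) < 1}" for d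
  have "\<exists>\<V>. finite \<V> \<and> \<V> \<subseteq> B ` D \<and> D \<subseteq> \<Union>\<V>"
  proof (rule compactinD[OF D])
    show "openin \<tau> U" if "U \<in> B ` D" for U
      using that q(1) by (auto simp: B_def cont_seminorm_def)
    show "D \<subseteq> \<Union> (B ` D)"
      using q(1) by (force simp: B_def cont_seminorm_def seminorm_zero)
  qed
  then obtain I where I: "I \<subseteq> D" "finite I" "D \<subseteq> (\<Union>i\<in>I. B i)"
    by (metis finite_subset_image)
  show ?thesis
  proof
    show "cont_seminorm \<tau> (\<lambda>x. \<Sum>i\<in>I. q i x)"
      using I q(1) by (intro cont_seminorm_sum top) auto
    fix c d assume c: "c \<in> C" and d: "d \<in> D"
    then obtain i where i: "i \<in> I" "q i (d - i) < 1"
      using I by (auto simp: B_def)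
    have sn: "seminorm (q j)" if "j \<in> I" for j
      using q(1) I that by (auto simp: cont_seminorm_def)
    have "2 \<le> q i (c - i)" using q(2) c i I by auto
    also have "\<dots> \<le> q i (c - d) + q i (d - i)"
      by (rule seminorm_triangle[OF sn[OF i(1)]])
    finally have "1 \<le> q i (c - d)" using i by simp
    also have "\<dots> \<le> (\<Sum>j\<in>I. q j (c - d))"
      using i(1) I(2) sn seminorm_nonneg by (intro member_le_sum) auto
    finally show "1 \<le> (\<Sum>j\<in>I. q j (c - d))" .
  qed
qed

lemma separation_closure_compact:
  fixes F :: "('a::real_vector \<Rightarrow> real) set"
  defines "\<tau> \<equiv> seminorm_topology F"
  assumes F: "\<And>p. p \<in> F \<Longrightarrow> seminorm p"
    and C: "convex C" "C \<noteq> {}" and D: "convex D" "D \<noteq> {}"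
    and compact: "compactin \<tau> (\<tau> closure_of D) \<or> compactin \<tau> (\<tau> closure_of C)"
    and disj: "\<tau> closure_of C \<inter> \<tau> closure_of D = {}"
  obtains f where "f \<in> topological_dual \<tau>" "\<And>c d. c \<in> C \<Longrightarrow> d \<in> D \<Longrightarrow> f d + 1 \<le> f c"
proof -
  have top: "topspace \<tau> = UNIV" by (simp add: \<tau>_def)
  have sub: "C \<subseteq> \<tau> closure_of C" "D \<subseteq> \<tau> closure_of D"
    by (simp_all add: closure_of_subset top)
  obtain q where q: "cont_seminorm \<tau> q" "\<And>c d. c \<in> C \<Longrightarrow> d \<in> D \<Longrightarrow> 1 \<le> q (c - d)"
    using compact
  proof
    assume "compactin \<tau> (\<tau> closure_of D)"
    then obtain q where "cont_seminorm \<tau> q"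
        "\<And>c d. c \<in> \<tau> closure_of C \<Longrightarrow> d \<in> \<tau> closure_of D \<Longrightarrow> 1 \<le> q (c - d)"
      using compact_closed_uniform_gap[of F, OF F, folded \<tau>_def, where C = "\<tau> closure_of C" and D = "\<tau> closure_of D"] disj
      by auto
    then show ?thesis using sub by (intro that[of q]) auto
  next
    \<comment> \<open>The gap lemma is applied with the roles of the sets exchanged; symmetry of the
      seminorm turns \<open>d - c\<close> back into \<open>c - d\<close>.\<close>
    assume "compactin \<tau> (\<tau> closure_of C)"
    then obtain q where q: "cont_seminorm \<tau> q"
        "\<And>d c. d \<in> \<tau> closure_of D \<Longrightarrow> c \<in> \<tau> closure_of C \<Longrightarrow> 1 \<le> q (d - c)"
      using compact_closed_uniform_gap[of F, OF F, folded \<tau>_def, where C = "\<tau> closure_of D" and D = "\<tau> closure_of C"] disj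
      by auto
    show ?thesis
    proof (rule that[OF q(1)])
      fix c d assume "c \<in> C" "d \<in> D"
      then have "1 \<le> q (d - c)" using sub by (intro q(2)) auto
      also have "\<dots> = q (c - d)"
        using q(1) by (intro seminorm_minus_commute) (simp add: cont_seminorm_def)
      finally show "1 \<le> q (c - d)" .
    qed
  qed
  have sn: "seminorm q" using q(1) by (simp add: cont_seminorm_def)
  \<comment> \<open>Separating \<open>C\<close> from \<open>D\<close> amounts to bounding
    \<open>f\<close> below on the convex set of differences, where \<open>q\<close> is at least
    1.\<close>
  obtain f where f: "linear f" "f \<le> q" "\<And>w. w \<in> (\<Union>c\<in>C. \<Union>d\<in>D. {c - d}) \<Longrightarrow> 1 \<le> f w"
  proof (rule linear_below_sublinear_above_one[OF seminorm_imp_sublinear[OF sn]])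
    show "convex (\<Union>c\<in>C. \<Union>d\<in>D. {c - d})"
      using C D by (intro convex_differences)
  qed (use C D q in auto)
  \<comment> \<open>Domination by the symmetric \<open>q\<close> at \<open>y - x\<close> and at
    \<open>x - y\<close> makes \<open>f\<close> Lipschitz for \<open>q\<close>, hence
    continuous.\<close>
  have "\<bar>f y - f x\<bar> \<le> q (y - x)" for x y
    using le_funD[OF f(2), of "y - x"] le_funD[OF f(2), of "x - y"]
      seminorm_minus_commute[OF sn, of x y] by (simp add: linear_diff[OF f(1)] abs_le_iff)
  then have "f \<in> topological_dual \<tau>"
    using f(1) lipschitz_imp_continuous_map[OF q(1)]
    by (simp add: topological_dual_def algebraic_dual_def)
  moreover have "f d + 1 \<le> f c" if "c \<in> C" "d \<in> D" for c d
  proof -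
    have "1 \<le> f (c - d)" using that by (intro f(3)) auto
    then show ?thesis by (simp add: linear_diff[OF f(1)])
  qed
  ultimately show ?thesis by (rule that)
qed

section \<open>From normlike-bases to cones\<close>

lemma cone_to_normlike_base:
  assumes "seminorm \<psi>" "nontrivial_cone K" "has_normlike_base \<psi> K" "x \<in> K" "x \<noteq> 0"
  shows "0 < \<psi> x" "inverse (\<psi> x) *\<^sub>R x \<in> normlike_base \<psi> K"
proof -
  show pos: "0 < \<psi> x" using assms by (simp add: has_normlike_base_def)
  then show "inverse (\<psi> x) *\<^sub>R x \<in> normlike_base \<psi> K"
    using assms by (simp add: normlike_base_def nontrivial_cone_def cone_def seminormD)
qed

theorem theorem5p9:
  fixes F :: "('a::real_vector \<Rightarrow> real) set" and \<tau> :: "'a topology"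
    and \<psi> :: "'a \<Rightarrow> real" and K A :: "'a set"
  assumes lcs: "locally_convex_space F \<tau>"
    and psi: "seminorm \<psi>"
    and K: "nontrivial_cone K" "has_normlike_base \<psi> K" "pointed K"
    and A: "nontrivial_cone A" "has_normlike_base \<psi> A"
    and compact: "compactin \<tau> (\<tau> closure_of S_neg \<psi> K) \<or> compactin \<tau> (\<tau> closure_of S_zero \<psi> A)"
    and disjoint: "(\<tau> closure_of S_zero \<psi> A) \<inter> (\<tau> closure_of S_neg \<psi> K) = {}"
  shows "(\<exists>(x, \<alpha>) \<in> aug_sharp_top \<tau> \<psi> K \<inter> (topological_dual \<tau> \<times> {0<..}).
            (\<forall>a\<in>A. \<forall>k\<in>uminus ` K.
               x a + \<alpha> * \<psi> a \<ge> 0 \<and> 0 \<ge> x k + \<alpha> * \<psi> k) \<and>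
            (\<forall>a\<in>A - {0}. \<forall>k\<in>uminus ` K - {0}.
               x a + \<alpha> * \<psi> a > 0 \<and> 0 > x k + \<alpha> * \<psi> k)) \<and>
         A \<inter> (uminus ` K - {0}) = {} \<and>
         0 \<notin> \<tau> closure_of S_neg \<psi> K"
proof -
  have F: "\<And>p. p \<in> F \<Longrightarrow> seminorm p" and \<tau>: "\<tau> = seminorm_topology F"
    using lcs by (auto simp: locally_convex_space_def)
  have zero: "0 \<in> S_zero \<psi> A"
    by (simp add: S_zero_def hull_inc)
  obtain y where "y \<in> K" "y \<noteq> 0"
    using K(1) by (auto simp: nontrivial_cone_def)
  from cone_to_normlike_base(2)[OF psi K(1,2) this] have ne: "S_neg \<psi> K \<noteq> {}"
    by (auto simp: S_neg_def)
  have convex: "convex (S_zero \<psi> A)" "convex (S_neg \<psi> K)"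
    by (simp_all add: S_zero_def S_neg_def convex_convex_hull)
  obtain f where f: "f \<in> topological_dual \<tau>"
      "\<And>c d. c \<in> S_zero \<psi> A \<Longrightarrow> d \<in> S_neg \<psi> K \<Longrightarrow> f d + 1 \<le> f c"
    using separation_closure_compact[OF F convex(1) _ convex(2) ne] zero compact disjoint
    unfolding \<tau> by blast
  have lin: "linear f"
    using f(1) by (simp add: topological_dual_def algebraic_dual_def)
  have le: "f d \<le> - 1" if "d \<in> S_neg \<psi> K" for d
    using f(2)[OF zero that] by (simp add: linear_0[OF lin])
  \<comment> \<open>The level \<open>- \<alpha>\<close> lies 1/2 above the supremum of
    \<open>f\<close> on \<open>S_neg \<psi> K\<close>; the gap of 1 keeps it at least 1/2 below
    every value of \<open>f\<close> on \<open>S_zero \<psi> A\<close>.\<close>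
  define \<alpha> where "\<alpha> = - (SUP d\<in>S_neg \<psi> K. f d) - 1 / 2"
  have below: "f d < - \<alpha>" if "d \<in> S_neg \<psi> K" for d
    using cSUP_upper[of d "S_neg \<psi> K" f] le that by (fastforce simp: \<alpha>_def intro: bdd_aboveI2)
  have above: "- \<alpha> < f c" if "c \<in> S_zero \<psi> A" for c
    using cSUP_least[OF ne, of f "f c - 1"] f(2)[OF that] by (fastforce simp: \<alpha>_def)
  \<comment> \<open>This is where adjoining 0 to the base of \<open>A\<close> pays off: the level
    lies strictly below \<open>f 0 = 0\<close>.\<close>
  have \<alpha>: "0 < \<alpha>"
    using above[OF zero] by (simp add: linear_0[OF lin])
  have A_pos: "0 < f a + \<alpha> * \<psi> a" if "a \<in> A" "a \<noteq> 0" for a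
  proof -
    note base = cone_to_normlike_base[OF psi A that]
    have "- \<alpha> < f (inverse (\<psi> a) *\<^sub>R a)"
      using base(2) by (intro above) (simp add: S_zero_def hull_inc)
    then show ?thesis using base(1) by (simp add: linear_scale[OF lin] field_simps)
  qed
  \<comment> \<open>This is the inequality defining \<open>aug_sharp\<close>; symmetry of
    \<open>\<psi>\<close> turns it into the required one on \<open>- K\<close>.\<close>
  have K_pos: "0 < f k - \<alpha> * \<psi> k" if "k \<in> K" "k \<noteq> 0" for k
  proof -
    note base = cone_to_normlike_base[OF psi K(1,2) that]
    have "f (- (inverse (\<psi> k) *\<^sub>R k)) < - \<alpha>"
      using base(2) by (intro below) (simp add: S_neg_def hull_inc)
    then show ?thesis
      using base(1) by (simp add: linear_scale[OF lin] linear_neg[OF lin] field_simps)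
  qed
  have K_neg: "f k + \<alpha> * \<psi> k < 0" if "k \<in> uminus ` K" "k \<noteq> 0" for k
    using that K_pos[of "- k"] by (auto simp: linear_neg[OF lin] seminormD(3)[OF psi])
  have zero_val: "f 0 + \<alpha> * \<psi> 0 = 0"
    by (simp add: linear_0[OF lin] seminorm_zero[OF psi])
  have "0 < f k" if "k \<in> K" "k \<noteq> 0" for k
    using K_pos[OF that] mult_pos_pos[OF \<alpha> cone_to_normlike_base(1)[OF psi K(1,2) that]] by simp
  then have "(f, \<alpha>) \<in> aug_sharp_top \<tau> \<psi> K \<inter> (topological_dual \<tau> \<times> {0<..})"
    using f(1) \<alpha> K_pos
    by (auto simp: aug_sharp_top_def aug_sharp_def sharp_cone_def topological_dual_def)
  moreover have "f a + \<alpha> * \<psi> a \<ge> 0" if "a \<in> A" for a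
    using A_pos[OF that] zero_val by (cases "a = 0") auto
  moreover have "0 \<ge> f k + \<alpha> * \<psi> k" if "k \<in> uminus ` K" for k
    using K_neg[OF that] zero_val by (cases "k = 0") auto
  \<comment> \<open>A common nonzero point would give \<open>f + \<alpha> * \<psi>\<close> both
    signs.\<close>
  moreover have "A \<inter> (uminus ` K - {0}) = {}"
    using A_pos K_neg by fastforce
  moreover have "0 \<notin> \<tau> closure_of S_neg \<psi> K"
    using disjoint zero closure_of_subset[of "S_zero \<psi> A" \<tau>] by (auto simp: \<tau>)
  ultimately show ?thesis using A_pos K_neg by blast
qed

end
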